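(* Let $E$ be a graph, and let $E_{(v,w)}$ be its shift, formed from vertices $v,w\in E^0$ with $v$ regular and an injection $\theta\colon s_E^{-1}(v)\to s_E^{-1}(w)$ such that $t_E(e)=t_E(\theta(e))$ for all $e\in s_E^{-1}(v)$. Then the formulas $$f(u)=u\ \text{ for }u\in E^0,\qquad f(e)=\begin{cases}e& \text{for } e\in E^1\setminus\theta(s_E^{-1}(v))\\ x_{w,v}\,\theta^{-1}(e)& \text{for } e\in\theta(s_E^{-1}(v))\end{cases}$$ define a regular monotonic path homomorphism of graphs $f\colon E\to E_{(v,w)}$, that is, a map $f\colon \mathrm{FP}(E)\to\mathrm{FP}(E_{(v,w)})$.
   Context: A graph $E=(E^0,E^1,s_E,t_E)$ consists of arbitrary sets of vertices and edges with source and target maps. A vertex $v$ is regular if $s_E^{-1}(v)$ is finite and nonempty; $\mathrm{reg}(E)$ is the set of regular vertices, and $\mathrm{reg}_0(E)=\{v\in\mathrm{reg}(E)\mid s_E^{-1}(v)=\{e\}\text{ and }t_E(e)=v\}$. $\mathrm{FP}(E)$ is the set of finite paths (vertices, of length $0$, and sequences $e_1\ldots e_n$ of edges with $t_E(e_i)=s_E(e_{i+1})$); source and target extend to paths, and vertices act as units for concatenation. Write $\alpha\preceq\beta$ if $\beta=\alpha\gamma$ for some path $\gamma$. Shift: given $v,w,\theta$ as in the claim, $E_{(v,w)}^0=E^0$, $E_{(v,w)}^1=(E^1\setminus\theta(s_E^{-1}(v)))\sqcup\{x_{w,v}\}$, sources and targets of the edges in $E^1\setminus\theta(s_E^{-1}(v))$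 are as in $E$, and the new edge $x_{w,v}$ has source $w$ and target $v$. A path homomorphism from $E$ to $F$ is a map $f\colon \mathrm{FP}(E)\to\mathrm{FP}(F)$ with $f(E^0)\subseteq F^0$, commuting with source and target, and with $f(pq)=f(p)f(q)$ whenever $t_E(p)=s_E(q)$. It is monotonic if for edges $e,e'\in E^1$, $f(e)\preceq f(e')$ implies $e=e'$. For $v\in\mathrm{reg}(E)$ consider the condition $(\ast_v)$: (a) $f$ is injective on $s_E^{-1}(v)$; and (b) a path $p$ in $F$ lies in $f(s_E^{-1}(v))$ if and only if (i) $p=e_1\ldots e_n$ with $n\ge1$ and all $e_i\in F^1$, (ii) $pq\in f(s_E^{-1}(v))$ implies $q=t_F(p)$, and (iii) for all $i\in\{1,\ldots,n\}$ and $e\in s_F^{-1}(s_F(e_i))$ there is $r\in\mathrm{FP}(F)$ with $e_1\ldots e_{i-1}er\in f(s_E^{-1}(v))$. The path homomorphism $f$ is regular if $(\ast_v)$ holds for every $v\in\mathrm{reg}(E)\setminus\mathrm{reg}_0(E)$ and, for every $v\in\mathrm{reg}_0(E)$, either $(\ast_v)$ holds or $f(s_E^{-1}(v))=\{f(v)\}$.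
   Formalization: The formal statement assumes v ≠ w; if v = w, θ is a bijection of the finite nonempty set s_E^{-1}(v), so all its edges are removed from the shift and x_{w,v}θ^{-1}(e) is never a path there. *)

theory Defs
  imports "Graph_Theory.Arc_Walk" "HOL-Library.FuncSet"
begin

text \<open>
  Graphs are \<^locale>\<open>wf_digraph\<close>s, of arbitrary cardinality and with parallel arcs;
  the set of arcs with source \<open>v\<close> is \<^term>\<open>out_arcs E v\<close>.
  A finite path is a pair of its source and its list of arcs, so that the paths of length 0 are
  the pairs \<open>(u, [])\<close>.
\<close>

type_synonym ('v, 'e) path = "'v \<times> 'e list"

definition FP :: "('v, 'e) pre_digraph \<Rightarrow> ('v, 'e) path set" where
  "FP G = {(u, es). \<exists>z. pre_digraph.awalk G u es z}"

definition vpath :: "'v \<Rightarrow> ('v, 'e) path" where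
  "vpath u = (u, [])"

definition epath :: "('v, 'e) pre_digraph \<Rightarrow> 'e \<Rightarrow> ('v, 'e) path" where
  "epath G e = (tail G e, [e])"

definition psource :: "('v, 'e) path \<Rightarrow> 'v" where
  "psource p = fst p"

definition ptarget :: "('v, 'e) pre_digraph \<Rightarrow> ('v, 'e) path \<Rightarrow> 'v" where
  "ptarget G p = pre_digraph.awlast G (fst p) (snd p)"

text \<open>Concatenation is only meaningful if the target of \<open>p\<close> is the source of \<open>q\<close>.\<close>

definition pconcat :: "('v, 'e) path \<Rightarrow> ('v, 'e) path \<Rightarrow> ('v, 'e) path" where
  "pconcat p q = (fst p, snd p @ snd q)"

text \<open>Note the direction: the smaller path is the longer one.\<close>

definition path_le :: "('v, 'e) pre_digraph \<Rightarrow> ('v, 'e) path \<Rightarrow> ('v, 'e) path \<Rightarrow> bool" where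
  "path_le G a b \<longleftrightarrow> (\<exists>c\<in>FP G. ptarget G b = psource c \<and> a = pconcat b c)"

definition reg :: "('v, 'e) pre_digraph \<Rightarrow> 'v set" where
  "reg G = {v \<in> verts G. finite (out_arcs G v) \<and> out_arcs G v \<noteq> {}}"

definition reg0 :: "('v, 'e) pre_digraph \<Rightarrow> 'v set" where
  "reg0 G = {v \<in> reg G. \<exists>e. out_arcs G v = {e} \<and> head G e = v}"

locale path_hom = E: wf_digraph E + F: wf_digraph F
  for E :: "('v, 'e) pre_digraph" and F :: "('w, 'd) pre_digraph" +
  fixes f :: "('v, 'e) path \<Rightarrow> ('w, 'd) path"
  assumes maps_paths: "f \<in> FP E \<rightarrow> FP F"
    and maps_verts: "u \<in> verts E \<Longrightarrow> f (vpath u) \<in> vpath ` verts F"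
    and source_compat: "p \<in> FP E \<Longrightarrow> vpath (psource (f p)) = f (vpath (psource p))"
    and target_compat: "p \<in> FP E \<Longrightarrow> vpath (ptarget F (f p)) = f (vpath (ptarget E p))"
    and concat_compat: "p \<in> FP E \<Longrightarrow> q \<in> FP E \<Longrightarrow> ptarget E p = psource q \<Longrightarrow>
      f (pconcat p q) = pconcat (f p) (f q)"

definition monotonic_path_hom ::
  "('v, 'e) pre_digraph \<Rightarrow> ('w, 'd) pre_digraph \<Rightarrow> (('v, 'e) path \<Rightarrow> ('w, 'd) path) \<Rightarrow> bool" where
  "monotonic_path_hom E F f \<longleftrightarrow> path_hom E F f \<and>
    (\<forall>e\<in>arcs E. \<forall>e'\<in>arcs E. path_le F (f (epath E e)) (f (epath E e')) \<longrightarrow> e = e')"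

definition out_image ::
  "('v, 'e) pre_digraph \<Rightarrow> (('v, 'e) path \<Rightarrow> ('w, 'd) path) \<Rightarrow> 'v \<Rightarrow> ('w, 'd) path set" where
  "out_image E f v = (\<lambda>e. f (epath E e)) ` out_arcs E v"

text \<open>The condition \<open>(\<ast>\<^sub>v)\<close>; list positions are counted from 0.\<close>

definition star_cond ::
  "('v, 'e) pre_digraph \<Rightarrow> ('w, 'd) pre_digraph \<Rightarrow> (('v, 'e) path \<Rightarrow> ('w, 'd) path) \<Rightarrow> 'v \<Rightarrow> bool" where
  "star_cond E F f v \<longleftrightarrow>
    inj_on (\<lambda>e. f (epath E e)) (out_arcs E v) \<and>
    (\<forall>p\<in>FP F. p \<in> out_image E f v \<longleftrightarrow>
       (snd p \<noteq> [] \<and> set (snd p) \<subseteq> arcs F) \<and>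
       (\<forall>q\<in>FP F. ptarget F p = psource q \<longrightarrow> pconcat p q \<in> out_image E f v \<longrightarrow>
          q = vpath (ptarget F p)) \<and>
       (\<forall>i<length (snd p). \<forall>e\<in>out_arcs F (tail F (snd p ! i)).
          \<exists>r\<in>FP F. psource r = head F e \<and>
            pconcat (psource p, take i (snd p) @ [e]) r \<in> out_image E f v))"

definition regular_path_hom ::
  "('v, 'e) pre_digraph \<Rightarrow> ('w, 'd) pre_digraph \<Rightarrow> (('v, 'e) path \<Rightarrow> ('w, 'd) path) \<Rightarrow> bool" where
  "regular_path_hom E F f \<longleftrightarrow> path_hom E F f \<and>
    (\<forall>v\<in>reg E - reg0 E. star_cond E F f v) \<and>
    (\<forall>v\<in>reg0 E. star_cond E F f v \<or> out_image E f v = {f (vpath v)})"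

text \<open>The new arc from \<open>w\<close> to \<open>v\<close> is \<^term>\<open>Inr ()\<close>.\<close>

definition shift ::
  "('v, 'e) pre_digraph \<Rightarrow> 'v \<Rightarrow> 'v \<Rightarrow> ('e \<Rightarrow> 'e) \<Rightarrow> ('v, 'e + unit) pre_digraph" where
  "shift E v w \<theta> =
    \<lparr> verts = verts E,
      arcs = (arcs E - \<theta> ` out_arcs E v) <+> {()},
      tail = case_sum (tail E) (\<lambda>_. w),
      head = case_sum (head E) (\<lambda>_. v) \<rparr>"

text \<open>
  The formulas only make sense for \<open>v \<noteq> w\<close>: for \<open>v = w\<close> the arcs \<open>\<theta>\<^sup>-\<^sup>1(e)\<close> are themselves among
  those removed from \<open>E\<close>.
\<close>

definition shift_formulas ::
  "('v, 'e) pre_digraph \<Rightarrow> 'v \<Rightarrow> 'v \<Rightarrow> ('e \<Rightarrow> 'e) \<Rightarrow>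
    (('v, 'e) path \<Rightarrow> ('v, 'e + unit) path) \<Rightarrow> bool" where
  "shift_formulas E v w \<theta> f \<longleftrightarrow>
    (\<forall>u\<in>verts E. f (vpath u) = vpath u) \<and>
    (\<forall>e\<in>arcs E - \<theta> ` out_arcs E v. f (epath E e) = epath (shift E v w \<theta>) (Inl e)) \<and>
    (\<forall>e\<in>\<theta> ` out_arcs E v. f (epath E e) =
       pconcat (epath (shift E v w \<theta>) (Inr ()))
         (epath (shift E v w \<theta>) (Inl (inv_into (out_arcs E v) \<theta> e))))"

end

theory Submission
  imports Defs
begin

text \<open>
  A path homomorphism is determined by its values on vertices and arcs, and these values can be
  chosen freely subject to matching end points. The shift replaces the arcs \<open>\<theta>(e)\<close> at \<open>w\<close> by the
  paths \<open>x e\<close>, where \<open>x\<close> is the new arc, so the images of the arcs at \<open>w\<close> are obtained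
  from the arcs of the shift at \<open>w\<close> by splitting the single arc \<open>x\<close> along all arcs at its target
  \<open>v\<close>, while the arcs at any other vertex are unchanged. Both kinds of path sets satisfy
  \<open>(\<ast>)\<close>, at every vertex, and no member of them is a proper prefix of another.
\<close>

section \<open>Paths as lists of arcs\<close>

lemma ptarget_Nil [simp]: "ptarget G (u, []) = u"
  by (simp add: ptarget_def pre_digraph.awalk_verts_conv)

lemma ptarget_Cons [simp]: "ptarget G (u, e # es) = ptarget G (head G e, es)"
  by (simp add: ptarget_def pre_digraph.awalk_verts_conv)

lemma ptarget_append: "ptarget G (u, xs @ ys) = ptarget G (ptarget G (u, xs), ys)"
  by (induction xs arbitrary: u) auto

lemma psource_Pair [simp]: "psource (u, es) = u"
  by (simp add: psource_def)

lemma pconcat_Pair [simp]: "pconcat (u, xs) (z, ys) = (u, xs @ ys)"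
  by (simp add: pconcat_def)

context wf_digraph
begin

lemma FP_Nil_iff [simp]: "(u, []) \<in> FP G \<longleftrightarrow> u \<in> verts G"
  by (auto simp: FP_def awalk_Nil_iff)

lemma FP_Cons_iff [simp]:
  "(u, e # es) \<in> FP G \<longleftrightarrow> e \<in> arcs G \<and> u = tail G e \<and> (head G e, es) \<in> FP G"
  by (auto simp: FP_def awalk_Cons_iff)

lemma FP_append_iff:
  "(u, xs @ ys) \<in> FP G \<longleftrightarrow> (u, xs) \<in> FP G \<and> (ptarget G (u, xs), ys) \<in> FP G"
proof (induction xs arbitrary: u)
  case Nil
  \<comment> \<open>Even the empty prefix has to be a path, so \<open>u\<close> must be a vertex;
    the walk \<open>ys\<close> starting at \<open>u\<close> supplies this.\<close>
  have "u \<in> verts G" if "(u, ys) \<in> FP G"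
    using that by (auto simp: FP_def)
  then show ?case by auto
qed auto

lemma ptarget_in_verts: "(u, es) \<in> FP G \<Longrightarrow> ptarget G (u, es) \<in> verts G"
  by (induction es arbitrary: u) auto

end

section \<open>Path homomorphisms from their values on vertices and arcs\<close>

lemma path_hom_ext:
  assumes f: "path_hom E F f" and g: "path_hom E F g"
    and verts: "\<And>u. u \<in> verts E \<Longrightarrow> f (vpath u) = g (vpath u)"
    and arcs: "\<And>e. e \<in> arcs E \<Longrightarrow> f (epath E e) = g (epath E e)"
    and p: "p \<in> FP E"
  shows "f p = g p"
proof -
  interpret f: path_hom E F f by (fact f)
  interpret g: path_hom E F g by (fact g)
  have "f (u, es) = g (u, es)" if "(u, es) \<in> FP E" for u es
    using that
  proof (induction es arbitrary: u)
    case Nil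
    then show ?case using verts[of u] by (simp add: vpath_def)
  next
    case (Cons e es)
    then have e: "e \<in> arcs E" "u = tail E e" and es: "(head E e, es) \<in> FP E" by auto
    have eq: "(u, e # es) = pconcat (epath E e) (head E e, es)"
      using e by (simp add: epath_def)
    have "epath E e \<in> FP E" "ptarget E (epath E e) = psource (head E e, es)"
      using e by (auto simp: epath_def)
    then show ?case
      using f.concat_compat g.concat_compat es Cons.IH[OF es] arcs[OF e(1)] by (simp add: eq)
  qed
  then show ?thesis using p by (cases p) auto
qed

definition arc_subst :: "('e \<Rightarrow> 'd list) \<Rightarrow> ('v, 'e) path \<Rightarrow> ('v, 'd) path" where
  "arc_subst g p = (fst p, concat (map g (snd p)))"

lemma arc_subst_Pair [simp]: "arc_subst g (u, es) = (u, concat (map g es))"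
  by (simp add: arc_subst_def)

text \<open>Paths form the free category on the graph, so any choice of paths with the right end
  points extends along concatenation. Restricting to \<open>FP E\<close> makes the map extensional,
  as the uniqueness claim of the theorem requires.\<close>

lemma arc_subst_path_hom:
  fixes E :: "('v, 'e) pre_digraph" and F :: "('v, 'd) pre_digraph"
  assumes "wf_digraph E" "wf_digraph F" and verts: "verts E = verts F"
    and path: "\<And>e. e \<in> arcs E \<Longrightarrow> (tail E e, g e) \<in> FP F"
    and target: "\<And>e. e \<in> arcs E \<Longrightarrow> ptarget F (tail E e, g e) = head E e"
  shows "path_hom E F (restrict (arc_subst g) (FP E))"
proof -
  interpret E: wf_digraph E by fact
  interpret F: wf_digraph F by fact
  \<comment> \<open>By \<open>target\<close>, the word of an arc ends at its head, which is where
    the words of the remaining arcs begin.\<close>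
  have *: "(u, concat (map g es)) \<in> FP F \<and>
      ptarget F (u, concat (map g es)) = ptarget E (u, es)" if "(u, es) \<in> FP E" for u es
    using that
    by (induction es arbitrary: u) (auto simp: verts F.FP_append_iff ptarget_append path target)
  show ?thesis
  proof
    show "restrict (arc_subst g) (FP E) \<in> FP E \<rightarrow> FP F"
      using * by auto
    show "restrict (arc_subst g) (FP E) (vpath u) \<in> vpath ` verts F" if "u \<in> verts E" for u
      using that verts by (simp add: vpath_def)
    fix p assume p: "p \<in> FP E"
    obtain u es where p_eq: "p = (u, es)" by (cases p)
    have "u \<in> verts E" using p by (auto simp: p_eq FP_def E.awalk_hd_in_verts)
    then show "vpath (psource (restrict (arc_subst g) (FP E) p)) =
        restrict (arc_subst g) (FP E) (vpath (psource p))"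
      using p by (simp add: p_eq vpath_def)
    show "vpath (ptarget F (restrict (arc_subst g) (FP E) p)) =
        restrict (arc_subst g) (FP E) (vpath (ptarget E p))"
      using p * E.ptarget_in_verts by (simp add: p_eq vpath_def)
    show "restrict (arc_subst g) (FP E) (pconcat p q) =
        pconcat (restrict (arc_subst g) (FP E) p) (restrict (arc_subst g) (FP E) q)"
      if "q \<in> FP E" "ptarget E p = psource q" for q
      using that p by (cases q) (simp add: p_eq E.FP_append_iff)
  qed
qed

section \<open>Two kinds of path sets satisfying the condition \<open>star_cond\<close>\<close>

text \<open>The single arcs at \<open>u\<close> cut the tree of paths from \<open>u\<close> at depth
  one. Applying the third clause to the arcs of \<open>p\<close> itself shows that a path satisfying
  all clauses cannot leave this cut.\<close>

lemma star_cond_arcs: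
  assumes "wf_digraph F" and inj: "inj_on (\<lambda>e. f (epath E e)) (out_arcs E u)"
    and img: "out_image E f u = (\<lambda>a. (u, [a])) ` out_arcs F u"
  shows "star_cond E F f u"
proof -
  interpret F: wf_digraph F by fact
  have "p \<in> out_image E f u \<longleftrightarrow>
       (snd p \<noteq> [] \<and> set (snd p) \<subseteq> arcs F) \<and>
       (\<forall>q\<in>FP F. ptarget F p = psource q \<longrightarrow> pconcat p q \<in> out_image E f u \<longrightarrow>
          q = vpath (ptarget F p)) \<and>
       (\<forall>i<length (snd p). \<forall>e\<in>out_arcs F (tail F (snd p ! i)).
          \<exists>r\<in>FP F. psource r = head F e \<and>
            pconcat (psource p, take i (snd p) @ [e]) r \<in> out_image E f u)"
    (is "_ \<longleftrightarrow> ?i \<and> ?ii \<and> ?iii") if p: "p \<in> FP F" for p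
  proof
    assume "p \<in> out_image E f u"
    then obtain a where a: "a \<in> arcs F" "tail F a = u" "p = (u, [a])"
      by (auto simp: img)
    have ?ii by (auto simp: a img vpath_def)
    moreover have ?iii
    proof (intro allI impI ballI)
      fix i e assume "i < length (snd p)" "e \<in> out_arcs F (tail F (snd p ! i))"
      then have "(head F e, []) \<in> FP F" "i = 0" "e \<in> out_arcs F u" using a by auto
      then show "\<exists>r\<in>FP F. psource r = head F e \<and>
            pconcat (psource p, take i (snd p) @ [e]) r \<in> out_image E f u"
        by (intro bexI[of _ "(head F e, [])"]) (auto simp: a img)
    qed
    ultimately show "?i \<and> ?ii \<and> ?iii" using a by auto
  next
    assume R: "?i \<and> ?ii \<and> ?iii"
    then obtain z a as where p_eq: "p = (z, a # as)" by (cases p; cases "snd p") auto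
    have a: "a \<in> arcs F" "z = tail F a" using p by (auto simp: p_eq)
    \<comment> \<open>Position 0 with the path's own first arc: some member of the image starts at
      \<open>z\<close>.\<close>
    have "z = u" using R[THEN conjunct2, THEN conjunct2, rule_format, of 0 a] a
      by (auto simp: p_eq img)
    moreover have "as = []"
    proof (cases as)
      case (Cons b bs)
      then have "b \<in> arcs F" using p by (auto simp: p_eq)
      then show ?thesis
        \<comment> \<open>A second arc \<open>b\<close> would give a member with at least two
          arcs.\<close>
        using R[THEN conjunct2, THEN conjunct2, rule_format, of 1 b] Cons by (auto simp: p_eq img)
    qed
    ultimately show "p \<in> out_image E f u" using a by (auto simp: p_eq img)
  qed
  then show ?thesis using inj by (simp add: star_cond_def)
qed

text \<open>The cut is now at depth two below \<open>x\<close> and at depth one elsewhere. The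
  assumption \<open>ne\<close> serves twice: it provides a continuation of \<open>x\<close> for the
  third clause, and it gives \<open>[x]\<close> a proper extension, which excludes
  \<open>[x]\<close> by the second.\<close>

lemma star_cond_split_arc:
  assumes "wf_digraph F" and inj: "inj_on (\<lambda>e. f (epath E e)) (out_arcs E u)"
    and x: "x \<in> out_arcs F u" and ne: "out_arcs F (head F x) \<noteq> {}"
    and img: "out_image E f u =
      (\<lambda>a. (u, [a])) ` (out_arcs F u - {x}) \<union> (\<lambda>a. (u, [x, a])) ` out_arcs F (head F x)"
  shows "star_cond E F f u"
proof -
  interpret F: wf_digraph F by fact
  have "p \<in> out_image E f u \<longleftrightarrow>
       (snd p \<noteq> [] \<and> set (snd p) \<subseteq> arcs F) \<and>
       (\<forall>q\<in>FP F. ptarget F p = psource q \<longrightarrow> pconcat p q \<in> out_image E f u \<longrightarrow>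
          q = vpath (ptarget F p)) \<and>
       (\<forall>i<length (snd p). \<forall>e\<in>out_arcs F (tail F (snd p ! i)).
          \<exists>r\<in>FP F. psource r = head F e \<and>
            pconcat (psource p, take i (snd p) @ [e]) r \<in> out_image E f u)"
    (is "_ \<longleftrightarrow> ?i \<and> ?ii \<and> ?iii") if p: "p \<in> FP F" for p
  proof
    assume P: "p \<in> out_image E f u"
    \<comment> \<open>\<open>first\<close> and \<open>second\<close> provide the completions for
      positions 0 and 1; only a path consisting of \<open>x\<close> alone needs another arc.\<close>
    have first: "\<exists>r\<in>FP F. psource r = head F e \<and> (u, e # snd r) \<in> out_image E f u"
      if e: "e \<in> out_arcs F u" for e
    proof (cases "e = x")
      case True
      obtain b where "b \<in> out_arcs F (head F x)" using ne by blast
      then show ?thesis using True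
        by (intro bexI[of _ "(head F x, [b])"]) (auto simp: img)
    next
      case False
      then show ?thesis using e
        by (intro bexI[of _ "(head F e, [])"]) (auto simp: img)
    qed
    have second: "\<exists>r\<in>FP F. psource r = head F e \<and> (u, x # e # snd r) \<in> out_image E f u"
      if "e \<in> out_arcs F (head F x)" for e
      using that by (intro bexI[of _ "(head F e, [])"]) (auto simp: img)
    consider (one) a where "a \<in> out_arcs F u" "a \<noteq> x" "p = (u, [a])"
      | (two) a where "a \<in> out_arcs F (head F x)" "p = (u, [x, a])"
      using P unfolding img by blast
    then show "?i \<and> ?ii \<and> ?iii"
    proof cases
      case one
      then have ?ii by (auto simp: img vpath_def)
      moreover have ?iii using one first by (auto simp: pconcat_def)
      ultimately show ?thesis using one by auto
    next
      case two
      then have ?ii by (auto simp: img vpath_def)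
      moreover have ?iii using two first second x
        by (auto simp: pconcat_def less_Suc_eq)
      ultimately show ?thesis using two x by auto
    qed
  next
    assume R: "?i \<and> ?ii \<and> ?iii"
    then have ii: ?ii and iii: ?iii by auto
    obtain z a as where p_eq: "p = (z, a # as)" using R by (cases p; cases "snd p") auto
    have a: "a \<in> arcs F" "z = tail F a" using p by (auto simp: p_eq)
    have z: "z = u" using iii[rule_format, of 0 a] a by (auto simp: p_eq img)
    show "p \<in> out_image E f u"
    proof (cases as)
      case Nil
      have "a \<noteq> x"
      proof
        assume "a = x"
        obtain b where "b \<in> out_arcs F (head F x)" using ne by blast
        then show False
          using ii[rule_format, of "(head F x, [b])"] Nil z \<open>a = x\<close>
          by (auto simp: p_eq img vpath_def)
      qed
      then have "a \<in> out_arcs F u - {x}" "p = (u, [a])" using a z Nil by (auto simp: p_eq)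
      then show ?thesis unfolding img by blast
    next
      case (Cons b bs)
      then have b: "b \<in> arcs F" "tail F b = head F a" using p by (auto simp: p_eq)
      \<comment> \<open>Position 1 yields a member beginning with \<open>a\<close> and
        \<open>b\<close>, and all members with two arcs begin with \<open>x\<close>.\<close>
      have "a = x"
        using iii[rule_format, of 1 b] b Cons by (auto simp: p_eq img)
      moreover have "bs = []"
      proof (cases bs)
        case (Cons c cs)
        then have "c \<in> arcs F" using p \<open>as = b # bs\<close> by (auto simp: p_eq)
        then show ?thesis
          \<comment> \<open>A third arc would force a member with at least three arcs.\<close>
          using iii[rule_format, of 2 c] Cons \<open>as = b # bs\<close> by (auto simp: p_eq img)
      qed
      ultimately have "b \<in> out_arcs F (head F x)" "p = (u, [x, b])"
        using b z Cons by (auto simp: p_eq)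
      then show ?thesis unfolding img by blast
    qed
  qed
  then show ?thesis using inj by (simp add: star_cond_def)
qed

section \<open>The shifted graph and the words replacing the arcs of \<open>E\<close>\<close>

lemma shift_simps [simp]:
  "verts (shift E v w \<theta>) = verts E"
  "Inl e \<in> arcs (shift E v w \<theta>) \<longleftrightarrow> e \<in> arcs E - \<theta> ` out_arcs E v"
  "Inr () \<in> arcs (shift E v w \<theta>)"
  "tail (shift E v w \<theta>) (Inl e) = tail E e" "tail (shift E v w \<theta>) (Inr ()) = w"
  "head (shift E v w \<theta>) (Inl e) = head E e" "head (shift E v w \<theta>) (Inr ()) = v"
  by (auto simp: shift_def)

lemma out_arcs_shift:
  "out_arcs (shift E v w \<theta>) u =
    Inl ` (out_arcs E u - \<theta> ` out_arcs E v) \<union> (if u = w then {Inr ()} else {})"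
  by (auto simp: out_arcs_def shift_def)

locale graph_shift = wf_digraph E for E :: "('v, 'e) pre_digraph" +
  fixes v w :: 'v and \<theta> :: "'e \<Rightarrow> 'e"
  assumes v_reg: "v \<in> reg E" and w_vert: "w \<in> verts E" and v_neq_w: "v \<noteq> w"
    and theta: "\<theta> \<in> out_arcs E v \<rightarrow> out_arcs E w"
    and theta_inj: "inj_on \<theta> (out_arcs E v)"
    and theta_head: "e \<in> out_arcs E v \<Longrightarrow> head E e = head E (\<theta> e)"
begin

abbreviation F :: "('v, 'e + unit) pre_digraph" where
  "F \<equiv> shift E v w \<theta>"

definition arc_word :: "'e \<Rightarrow> ('e + unit) list" where
  "arc_word e = (if e \<in> \<theta> ` out_arcs E v then [Inr (), Inl (inv_into (out_arcs E v) \<theta> e)]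
    else [Inl e])"

lemma arc_word_theta [simp]:
  "e \<in> out_arcs E v \<Longrightarrow> arc_word (\<theta> e) = [Inr (), Inl e]"
  using theta_inj by (auto simp: arc_word_def)

lemma arc_word_other [simp]: "e \<notin> \<theta> ` out_arcs E v \<Longrightarrow> arc_word e = [Inl e]"
  by (simp add: arc_word_def)

lemma tail_theta: "e \<in> out_arcs E v \<Longrightarrow> tail E (\<theta> e) = w \<and> \<theta> e \<in> arcs E"
  using theta by auto

text \<open>Since \<open>v\<close> and \<open>w\<close> differ, the arcs at \<open>v\<close> survive
  in the shift, so the second letter of \<open>arc_word (\<theta> e)\<close> is an arc
  there.\<close>

lemma out_v_not_theta: "e \<in> out_arcs E v \<Longrightarrow> e \<notin> \<theta> ` out_arcs E v"
  using tail_theta v_neq_w by force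

lemma arc_cases:
  obtains (theta) e' where "e' \<in> out_arcs E v" "e = \<theta> e'"
  | (other) "e \<notin> \<theta> ` out_arcs E v"
  by blast

lemma wf_shift: "wf_digraph F"
  using v_reg w_vert by unfold_locales (auto simp: shift_def reg_def)

sublocale F: wf_digraph F
  by (fact wf_shift)

lemma arc_word_path:
  assumes "e \<in> arcs E"
  shows "(tail E e, arc_word e) \<in> FP F" "ptarget F (tail E e, arc_word e) = head E e"
proof -
  have "(tail E e, arc_word e) \<in> FP F \<and> ptarget F (tail E e, arc_word e) = head E e"
  proof (cases e rule: arc_cases)
    case (theta e')
    then show ?thesis
      using tail_theta[of e'] out_v_not_theta[of e'] theta_head[of e'] by auto
  next
    case other
    then show ?thesis using assms by auto
  qed
  then show "(tail E e, arc_word e) \<in> FP F" "ptarget F (tail E e, arc_word e) = head E e"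
    by auto
qed

text \<open>A word starts with \<open>Inr ()\<close> exactly when its arc is replaced, words of the
  same kind have equal length, and each word determines its arc. Monotonicity and, with
  \<open>ys\<close> empty, injectivity both follow from this.\<close>

lemma arc_word_prefix:
  assumes "e \<in> arcs E" "e' \<in> arcs E" "arc_word e = arc_word e' @ ys"
  shows "e = e'"
  using assms by (cases e rule: arc_cases; cases e' rule: arc_cases) auto

text \<open>This merges the two cases for arcs, so that \<open>inv_into\<close> no longer appears
  outside \<open>arc_word\<close>.\<close>

lemma shift_formulas_iff:
  "shift_formulas E v w \<theta> f \<longleftrightarrow>
    (\<forall>u\<in>verts E. f (vpath u) = vpath u) \<and>
    (\<forall>e\<in>arcs E. f (epath E e) = (tail E e, arc_word e))"
proof -
  have "f (epath E e) = pconcat (epath F (Inr ()))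
        (epath F (Inl (inv_into (out_arcs E v) \<theta> e))) \<longleftrightarrow>
      f (epath E e) = (tail E e, arc_word e)" if "e \<in> \<theta> ` out_arcs E v" for e
    using that tail_theta theta_inj by (auto simp: epath_def)
  moreover have "arcs E = (arcs E - \<theta> ` out_arcs E v) \<union> \<theta> ` out_arcs E v"
    using tail_theta by auto
  then have "(\<forall>e\<in>arcs E. P e) \<longleftrightarrow>
      (\<forall>e\<in>arcs E - \<theta> ` out_arcs E v. P e) \<and> (\<forall>e\<in>\<theta> ` out_arcs E v. P e)" for P
    by blast
  ultimately show ?thesis
    unfolding shift_formulas_def by (simp add: epath_def)
qed

lemma path_hom_arc_word: "path_hom E F (restrict (arc_subst arc_word) (FP E))"
  by (rule arc_subst_path_hom) (use arc_word_path wf_shift in \<open>auto simp: wf_digraph\<close>)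

lemma shift_formulas_arc_word: "shift_formulas E v w \<theta> (restrict (arc_subst arc_word) (FP E))"
  by (auto simp: shift_formulas_iff vpath_def epath_def)

section \<open>Monotonicity and regularity of an arbitrary homomorphism satisfying the
  formulas\<close>

context
  fixes f
  assumes hom: "path_hom E F f" and formulas: "shift_formulas E v w \<theta> f"
begin

lemma image_arc: "e \<in> arcs E \<Longrightarrow> f (epath E e) = (tail E e, arc_word e)"
  using formulas by (simp add: shift_formulas_iff)

lemma out_image_eq: "out_image E f u = (\<lambda>e. (u, arc_word e)) ` out_arcs E u"
  unfolding out_image_def by (rule image_cong) (auto simp: image_arc)

lemma monotonic: "monotonic_path_hom E F f"
  unfolding monotonic_path_hom_def path_le_def
  using hom arc_word_prefix by (auto simp: image_arc)

lemma image_inj: "inj_on (\<lambda>e. f (epath E e)) (out_arcs E u)"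
  using arc_word_prefix[of _ _ "[]"] by (auto simp: inj_on_def image_arc)

lemma star_cond_shift: "star_cond E F f u"
proof (cases "u = w")
  case False
  \<comment> \<open>All removed arcs start at \<open>w\<close>, so nothing changes at other
    vertices.\<close>
  then have "out_arcs E u \<inter> \<theta> ` out_arcs E v = {}" using tail_theta by auto
  then have "out_arcs F u = Inl ` out_arcs E u"
    and "out_image E f u = (\<lambda>e. (u, [Inl e])) ` out_arcs E u"
    using False by (auto simp: out_arcs_shift out_image_eq disjoint_iff intro!: image_cong arc_word_other)
  then show ?thesis
    by (intro star_cond_arcs wf_shift image_inj) (simp add: image_image)
next
  case True
  have out_v: "out_arcs F v = Inl ` out_arcs E v"
    using v_neq_w out_v_not_theta by (auto simp: out_arcs_shift)
  \<comment> \<open>On each of the two pieces \<open>arc_word\<close> has a uniform shape.\<close>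
  have split: "out_arcs E w = (out_arcs E w - \<theta> ` out_arcs E v) \<union> \<theta> ` out_arcs E v"
    using theta by auto
  have "out_image E f w = (\<lambda>e. (w, [Inl e])) ` (out_arcs E w - \<theta> ` out_arcs E v) \<union>
      (\<lambda>e. (w, [Inr (), Inl e])) ` out_arcs E v"
    unfolding out_image_eq
    by (subst split) (simp add: image_Un image_image del: Un_Diff_cancel2 cong: image_cong_simp)
  moreover have "out_arcs F w - {Inr ()} = Inl ` (out_arcs E w - \<theta> ` out_arcs E v)"
    by (auto simp: out_arcs_shift)
  ultimately have "out_image E f w =
      (\<lambda>a. (w, [a])) ` (out_arcs F w - {Inr ()}) \<union>
      (\<lambda>a. (w, [Inr (), a])) ` out_arcs F (head F (Inr ()))"
    by (simp add: out_v image_image)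
  then show ?thesis
    \<comment> \<open>Regularity of \<open>v\<close> ensures that arcs leave the head of the new
      arc, as the splitting lemma demands.\<close>
    using v_reg True
    by (intro star_cond_split_arc[where x = "Inr ()"] wf_shift image_inj)
      (simp_all add: out_v reg_def)
qed

lemma regular: "regular_path_hom E F f"
  using hom star_cond_shift by (simp add: regular_path_hom_def)

end

end

theorem proposition5p14:
  fixes E :: "('v, 'e) pre_digraph" and v w :: 'v and \<theta> :: "'e \<Rightarrow> 'e"
  assumes "wf_digraph E"
    and "v \<in> reg E" and "w \<in> verts E" and "v \<noteq> w"
    and "\<theta> \<in> out_arcs E v \<rightarrow> out_arcs E w"
    and "inj_on \<theta> (out_arcs E v)"
    and "\<And>e. e \<in> out_arcs E v \<Longrightarrow> head E e = head E (\<theta> e)"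
  shows "(\<exists>!f. f \<in> extensional (FP E) \<and> path_hom E (shift E v w \<theta>) f \<and> shift_formulas E v w \<theta> f) \<and>
    (\<forall>f. path_hom E (shift E v w \<theta>) f \<and> shift_formulas E v w \<theta> f \<longrightarrow>
      regular_path_hom E (shift E v w \<theta>) f \<and> monotonic_path_hom E (shift E v w \<theta>) f)"
proof -
  interpret graph_shift E v w \<theta>
    by (intro graph_shift.intro graph_shift_axioms.intro) (use assms in auto)
  let ?f = "restrict (arc_subst arc_word) (FP E)"
  have "f = ?f" if "f \<in> extensional (FP E)" "path_hom E F f" "shift_formulas E v w \<theta> f" for f
  \<comment> \<open>Outside \<open>FP E\<close> both maps are fixed by extensionality; on paths they
    agree because the formulas prescribe all values on vertices and arcs.\<close>
  proof (rule extensionalityI[OF that(1)])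
    show "f p = ?f p" if "p \<in> FP E" for p
      using \<open>path_hom E F f\<close> path_hom_arc_word _ _ that
    proof (rule path_hom_ext)
      show "f (vpath u) = ?f (vpath u)" if "u \<in> verts E" for u
        using that \<open>shift_formulas E v w \<theta> f\<close> shift_formulas_arc_word
        unfolding shift_formulas_iff by metis
      show "f (epath E e) = ?f (epath E e)" if "e \<in> arcs E" for e
        using that \<open>shift_formulas E v w \<theta> f\<close> shift_formulas_arc_word
        unfolding shift_formulas_iff by metis
    qed
  qed simp
  then have "\<exists>!f. f \<in> extensional (FP E) \<and> path_hom E F f \<and> shift_formulas E v w \<theta> f"
    using path_hom_arc_word shift_formulas_arc_word by (intro ex1I[of _ ?f]) auto
  then show ?thesis using regular monotonic by blast
qed

end
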